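(* Let $r\ge 0$ be an integer and let $a,b$ be indeterminates. Then for all integers $n,k$ with $1\le k\le n$, $$\mathcal{G}_{a,b}(n,k;r)=\sum_{i=k}^n\mathcal{G}_{a,b}(i-1,k-1;r)\prod_{j=i}^{n-1}\bigl(aj+bk+(a+b)r\bigr),$$ and for all integers $n,k$ with $0\le k<n$, $$\mathcal{G}_{a,b}(n,k;r)=\sum_{i=0}^{k}\bigl(a(n+r-i-1)+b(k+r-i)\bigr)\,\mathcal{G}_{a,b}(n-i-1,k-i;r).$$
   Context: Write $[m]=\{1,\ldots,m\}$, $[0]=\varnothing$. A Lah distribution of $[m]$ into $\ell$ blocks is a partition of $[m]$ into $\ell$ non-empty, pairwise disjoint blocks in which the elements within each block are linearly ordered (the blocks themselves are not ordered). For integers $n,k,r$ with $0\le k\le n$ and $r\ge 0$, let $\mathcal{L}_r(n,k)$ be the set of Lah distributions of $[n+r]$ into $k+r$ blocks in which the elements of $[r]$ belong to distinct blocks. An element $i$ of a Lah distribution $\lambda$ is a record low if there is no element $j<i$ to the left of $i$ within its block. Let $rec^*(\lambda)$ be the number of record lows of $\lambda$ that are not the smallest element of their block, and let $nrec(\lambda)$ be the number of elements of the underlying set that are not record lows of $\lambda$. The generalized $r$-Lah number is the polynomial in indeterminates $a,b$ $$\mathcal{G}_{a,b}(n,k;r)=\sum_{\lambda\in\mathcal{L}_r(n,k)}a^{nrec(\lambda)}b^{rec^*(\lambda)},$$ with $\mathcal{G}_{a,b}(n,k;r)=0$ unless $0\le k\le n$ and $r\ge 0$. Empty sums are $0$ and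 empty products are $1$. *)

theory Defs
  imports "HOL-Computational_Algebra.Polynomial" "HOL-Library.Disjoint_Sets"
begin

text \<open>A linearly ordered block is a list without repetitions, and a Lah distribution is the
  (unordered) set of its blocks.\<close>

definition lah_distributions :: "nat \<Rightarrow> nat \<Rightarrow> nat list set set" where
  "lah_distributions m l =
     {D. (\<forall>xs\<in>D. xs \<noteq> [] \<and> distinct xs) \<and> disjoint_family_on set D \<and>
         (\<Union>xs\<in>D. set xs) = {1..m} \<and> card D = l}"

definition r_lah_distributions :: "nat \<Rightarrow> nat \<Rightarrow> nat \<Rightarrow> nat list set set" where
  "r_lah_distributions r n k =
     {D \<in> lah_distributions (n + r) (k + r).
        \<forall>xs\<in>D. \<forall>i\<in>{1..r}. \<forall>j\<in>{1..r}. i \<in> set xs \<and> j \<in> set xs \<longrightarrow> i = j}"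

definition left_of :: "nat list \<Rightarrow> nat \<Rightarrow> nat \<Rightarrow> bool" where
  "left_of xs j i \<longleftrightarrow> (\<exists>p q. p < q \<and> q < length xs \<and> xs ! p = j \<and> xs ! q = i)"

definition record_low :: "nat list \<Rightarrow> nat \<Rightarrow> bool" where
  "record_low xs i \<longleftrightarrow> i \<in> set xs \<and> \<not> (\<exists>j<i. left_of xs j i)"

definition rec_star :: "nat list set \<Rightarrow> nat" where
  "rec_star D = card {i. \<exists>xs\<in>D. record_low xs i \<and> i \<noteq> Min (set xs)}"

definition nrec :: "nat list set \<Rightarrow> nat" where
  "nrec D = card {i. \<exists>xs\<in>D. i \<in> set xs \<and> \<not> record_low xs i}"

text \<open>The polynomial ring in the two indeterminates \<open>a\<close>, \<open>b\<close> over the integers is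
  \<^typ>\<open>int poly poly\<close>: \<open>a\<close> is the inner variable, embedded as a constant, and \<open>b\<close> is the outer
  variable.\<close>

definition var_a :: "int poly poly" where
  "var_a = [:[:0, 1:]:]"

definition var_b :: "int poly poly" where
  "var_b = [:0, 1:]"

definition gen_r_lah :: "nat \<Rightarrow> nat \<Rightarrow> nat \<Rightarrow> int poly poly" where
  "gen_r_lah n k r =
     (if k \<le> n then \<Sum>D\<in>r_lah_distributions r n k. var_a ^ nrec D * var_b ^ rec_star D else 0)"

text \<open>The index set of the sum is finite, so the sum is not zero by convention; moreover each Lah
  distribution is a finite set, so that the cardinality condition is meaningful for \<open>l = 0\<close>.\<close>

lemma lah_distributions_subset:
  "lah_distributions m l \<subseteq> Pow {xs. distinct xs \<and> set xs \<subseteq> {1..m}}"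
  by (auto simp: lah_distributions_def)

lemma finite_distinct_lists: "finite {xs. distinct xs \<and> set xs \<subseteq> {1..m::nat}}"
proof (rule finite_subset)
  show "{xs. distinct xs \<and> set xs \<subseteq> {1..m}} \<subseteq> {xs. set xs \<subseteq> {1..m} \<and> length xs \<le> m}"
  proof clarify
    fix xs :: "nat list" assume "distinct xs" "set xs \<subseteq> {1..m}"
    then show "length xs \<le> m"
      using card_mono[of "{1..m}" "set xs"] by (simp add: distinct_card)
  qed
  show "finite {xs. set xs \<subseteq> {1..m} \<and> length xs \<le> m}"
    by (rule finite_lists_length_le) simp
qed

lemma finite_lah_distribution: "D \<in> lah_distributions m l \<Longrightarrow> finite D"
  using lah_distributions_subset finite_distinct_lists by (meson PowD finite_subset subsetD)

lemma finite_r_lah_distributions: "finite (r_lah_distributions r n k)"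
proof (rule finite_subset)
  show "r_lah_distributions r n k \<subseteq> lah_distributions (n + r) (k + r)"
    by (auto simp: r_lah_distributions_def)
  show "finite (lah_distributions (n + r) (k + r))"
    using lah_distributions_subset finite_distinct_lists by (meson finite_Pow_iff finite_subset)
qed

end

theory Submission
  imports Defs
begin

text \<open>Deleting the largest element \<open>n + r + 1\<close> from a distribution of \<open>[n + r + 1]\<close> does not affect
  the record lows among the other elements. The deleted element was either alone in its block, or
  stood at the front of one of the \<open>k + r\<close> blocks (a record low that is not minimal, weight \<open>b\<close>), or
  stood directly behind one of the \<open>n + r\<close> other elements (not a record low, weight \<open>a\<close>). Hence
  \<open>G(n + 1, k) = G(n, k - 1) + (a (n + r) + b (k + r)) G(n, k)\<close>, and both identities arise by
  iterating this recurrence, the first one on the second summand and the second one on the first.\<close>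

section \<open>Record lows under insertion of a largest element\<close>

text \<open>Trades index positions for set membership, so that the effect of splitting a block at an
  element becomes a matter of simplification.\<close>

lemma left_of_append:
  "left_of (xs @ ys) j i \<longleftrightarrow> left_of xs j i \<or> left_of ys j i \<or> (j \<in> set xs \<and> i \<in> set ys)"
proof
  assume "left_of (xs @ ys) j i"
  then obtain p q where pq: "p < q" "q < length xs + length ys" "(xs @ ys) ! p = j" "(xs @ ys) ! q = i"
    by (auto simp: left_of_def)
  consider "q < length xs" | "p < length xs" "length xs \<le> q" | "length xs \<le> p"
    by linarith
  then show "left_of xs j i \<or> left_of ys j i \<or> (j \<in> set xs \<and> i \<in> set ys)"
  proof cases
    case 1
    with pq have "left_of xs j i"
      unfolding left_of_def by (intro exI[of _ p] exI[of _ q]) (auto simp: nth_append)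
    then show ?thesis ..
  next
    case 2
    with pq show ?thesis by (auto simp: nth_append)
  next
    case 3
    with pq have "left_of ys j i"
      unfolding left_of_def
      by (intro exI[of _ "p - length xs"] exI[of _ "q - length xs"]) (auto simp: nth_append)
    then show ?thesis by simp
  qed
next
  assume "left_of xs j i \<or> left_of ys j i \<or> (j \<in> set xs \<and> i \<in> set ys)"
  then consider "left_of xs j i" | "left_of ys j i" | "j \<in> set xs" "i \<in> set ys"
    by blast
  then show "left_of (xs @ ys) j i"
  proof cases
    case 1
    then obtain p q where "p < q" "q < length xs" "xs ! p = j" "xs ! q = i"
      by (auto simp: left_of_def)
    then show ?thesis
      unfolding left_of_def by (intro exI[of _ p] exI[of _ q]) (auto simp: nth_append)
  next
    case 2
    then obtain p q where "p < q" "q < length ys" "ys ! p = j" "ys ! q = i"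
      by (auto simp: left_of_def)
    then show ?thesis
      unfolding left_of_def
      by (intro exI[of _ "length xs + p"] exI[of _ "length xs + q"]) (auto simp: nth_append)
  next
    case 3
    then obtain p q where "p < length xs" "xs ! p = j" "q < length ys" "ys ! q = i"
      by (auto simp: in_set_conv_nth)
    then show ?thesis
      unfolding left_of_def
      by (intro exI[of _ p] exI[of _ "length xs + q"]) (auto simp: nth_append)
  qed
qed

lemma left_of_Cons: "left_of (x # xs) j i \<longleftrightarrow> (j = x \<and> i \<in> set xs) \<or> left_of xs j i"
  using left_of_append[of "[x]" xs j i] by (auto simp: left_of_def)

lemma left_of_in_set:
  assumes "left_of xs j i"
  shows "j \<in> set xs" "i \<in> set xs"
  using assms by (auto simp: left_of_def)

text \<open>Only smaller elements to the left can spoil a record low, so the larger \<open>m\<close>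
  is invisible to \<open>i\<close>.\<close>

lemma record_low_insert_other:
  assumes "i < m"
  shows "record_low (ys @ m # zs) i \<longleftrightarrow> record_low (ys @ zs) i"
  using assms by (auto simp: record_low_def left_of_append left_of_Cons)

text \<open>Anything to the left of \<open>m\<close> is smaller than \<open>m\<close>, so a single
  such element already spoils the record low.\<close>

lemma record_low_insert_max:
  assumes "\<And>i. i \<in> set (ys @ zs) \<Longrightarrow> i < m"
  shows "record_low (ys @ m # zs) m \<longleftrightarrow> ys = []"
proof -
  have "m \<notin> set ys" "m \<notin> set zs"
    using assms[of m] by auto
  then show ?thesis
    using assms
    by (cases ys) (auto simp: record_low_def left_of_append left_of_Cons dest: left_of_in_set)
qed

section \<open>Factorization of the weight over the blocks\<close>

text \<open>The contribution of one block to the two exponents. Changing one block of a distribution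
  then changes a single factor of its weight.\<close>

definition block_weight :: "nat list \<Rightarrow> int poly poly" where
  "block_weight xs = var_a ^ card {i \<in> set xs. \<not> record_low xs i} *
     var_b ^ card {i \<in> set xs. record_low xs i \<and> i \<noteq> Min (set xs)}"

text \<open>The block was non-empty, so its minimum survives and differs from \<open>m\<close>.
  Hence \<open>m\<close> adds one to exactly one exponent: that of \<open>var_b\<close> if it is in
  front, that of \<open>var_a\<close> otherwise.\<close>

lemma block_weight_insert_max:
  assumes less: "\<And>i. i \<in> set (ys @ zs) \<Longrightarrow> i < m" and ne: "ys @ zs \<noteq> []"
  shows "block_weight (ys @ m # zs) = (if ys = [] then var_b else var_a) * block_weight (ys @ zs)"
proof -
  let ?S = "set (ys @ zs)"
  let ?N = "{i \<in> ?S. \<not> record_low (ys @ zs) i}"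
  let ?R = "{i \<in> ?S. record_low (ys @ zs) i \<and> i \<noteq> Min ?S}"
  have S: "finite ?S" "?S \<noteq> {}"
    using ne by auto
  have notin: "m \<notin> ?S"
    using less[of m] by blast
  have "Min ?S < m"
    using less Min_in[OF S] by blast
  then have Min: "Min (insert m ?S) = Min ?S"
    using S by (simp add: Min_insert)
  have set: "set (ys @ m # zs) = insert m ?S"
    by simp
  have other: "record_low (ys @ m # zs) i \<longleftrightarrow> record_low (ys @ zs) i" if "i \<in> ?S" for i
    using record_low_insert_other less[OF that] .
  have max: "record_low (ys @ m # zs) m \<longleftrightarrow> ys = []"
    using record_low_insert_max less .
  have N: "{i \<in> set (ys @ m # zs). \<not> record_low (ys @ m # zs) i} =
      (if ys = [] then ?N else insert m ?N)"
    unfolding set using other max by auto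
  have R: "{i \<in> set (ys @ m # zs). record_low (ys @ m # zs) i \<and> i \<noteq> Min (set (ys @ m # zs))} =
      (if ys = [] then insert m ?R else ?R)"
    unfolding set Min using other max \<open>Min ?S < m\<close> by auto
  have "card (insert m ?N) = Suc (card ?N)" "card (insert m ?R) = Suc (card ?R)"
    using notin by (intro card_insert_disjoint; simp)+
  then show ?thesis
    unfolding block_weight_def N R by (cases "ys = []") (simp_all only: simp_thms if_True if_False power_Suc mult_ac)
qed

lemma block_weight_singleton: "block_weight [m] = 1"
proof -
  have "record_low [m] m"
    by (auto simp: record_low_def left_of_def)
  then have "{i \<in> set [m]. \<not> record_low [m] i} = {}"
    "{i \<in> set [m]. record_low [m] i \<and> i \<noteq> Min (set [m])} = {}"
    by auto
  then show ?thesis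
    unfolding block_weight_def by (simp only: card.empty power_0 mult_1)
qed

text \<open>The blocks are disjoint, so both counts are sums over the blocks, and powers turn these
  sums into products.\<close>

lemma weight_eq_prod_block_weight:
  assumes "D \<in> lah_distributions m l"
  shows "var_a ^ nrec D * var_b ^ rec_star D = (\<Prod>xs\<in>D. block_weight xs)"
proof -
  have fin: "finite D"
    using finite_lah_distribution assms .
  have disj: "set xs \<inter> set ys = {}" if "xs \<in> D" "ys \<in> D" "xs \<noteq> ys" for xs ys
    using assms that by (auto simp: lah_distributions_def disjoint_family_on_def)
  have card: "card {i. \<exists>xs\<in>D. i \<in> set xs \<and> P xs i} = (\<Sum>xs\<in>D. card {i \<in> set xs. P xs i})" for P
  proof -
    have "{i. \<exists>xs\<in>D. i \<in> set xs \<and> P xs i} = (\<Union>xs\<in>D. {i \<in> set xs. P xs i})"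
      by auto
    also have "card \<dots> = (\<Sum>xs\<in>D. card {i \<in> set xs. P xs i})"
      using fin by (intro card_UN_disjoint) (use disj in \<open>fastforce+\<close>)
    finally show ?thesis .
  qed
  \<comment> \<open>A record low lies in its block by definition; making this explicit gives the
    shape to which \<open>card\<close> applies.\<close>
  have star: "rec_star D =
      card {i. \<exists>xs\<in>D. i \<in> set xs \<and> (record_low xs i \<and> i \<noteq> Min (set xs))}"
    unfolding rec_star_def by (rule arg_cong[where f = card]) (auto simp: record_low_def)
  show ?thesis
    unfolding nrec_def star card block_weight_def by (simp add: power_sum prod.distrib)
qed

text \<open>Sending each block to its first element is injective, as the blocks are
  disjoint.\<close>

lemma card_lah_distribution_le:
  assumes "D \<in> lah_distributions m l"
  shows "l \<le> m"
proof -
  have ne: "xs \<noteq> []" if "xs \<in> D" for xs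
    using assms that by (auto simp: lah_distributions_def)
  have "inj_on hd D"
  proof (rule inj_onI)
    fix xs ys assume xy: "xs \<in> D" "ys \<in> D" "hd xs = hd ys"
    then have "hd xs \<in> set xs \<inter> set ys"
      using hd_in_set[OF ne[of xs]] hd_in_set[OF ne[of ys]] by simp
    then show "xs = ys"
      using assms xy(1,2) unfolding lah_distributions_def disjoint_family_on_def by blast
  qed
  moreover have "hd ` D \<subseteq> {1..m}"
    using assms ne hd_in_set by (fastforce simp: lah_distributions_def)
  ultimately have "card D \<le> card {1..m}"
    by (intro card_inj_on_le) auto
  then show ?thesis
    using assms by (simp add: lah_distributions_def)
qed

text \<open>For \<open>k > n\<close> there would be more blocks than elements, so the index set is
  empty and both sides are 0.\<close>

lemma gen_r_lah_eq_sum: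
  "gen_r_lah n k r = (\<Sum>D\<in>r_lah_distributions r n k. \<Prod>xs\<in>D. block_weight xs)"
proof -
  have "r_lah_distributions r n k = {}" if "\<not> k \<le> n"
    using that card_lah_distribution_le by (fastforce simp: r_lah_distributions_def)
  moreover have "(\<Sum>D\<in>r_lah_distributions r n k. var_a ^ nrec D * var_b ^ rec_star D) =
      (\<Sum>D\<in>r_lah_distributions r n k. \<Prod>xs\<in>D. block_weight xs)"
    by (intro sum.cong refl weight_eq_prod_block_weight) (auto simp: r_lah_distributions_def)
  ultimately show ?thesis
    by (auto simp: gen_r_lah_def)
qed

section \<open>Membership conditions with one block singled out\<close>

text \<open>Separates the conditions on \<open>xs\<close> from those on \<open>E\<close>, so that
  distributions differing in one block can be compared condition by condition. Finiteness of
  \<open>E\<close> is stated explicitly for the sake of the cardinality.\<close>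

lemma insert_in_r_lah_distributions_iff:
  assumes "xs \<notin> E"
  shows "insert xs E \<in> r_lah_distributions r n k \<longleftrightarrow>
    xs \<noteq> [] \<and> distinct xs \<and> (\<forall>i\<in>{1..r}. \<forall>j\<in>{1..r}. i \<in> set xs \<and> j \<in> set xs \<longrightarrow> i = j) \<and>
    set xs \<inter> (\<Union>ys\<in>E. set ys) = {} \<and> set xs \<union> (\<Union>ys\<in>E. set ys) = {1..n + r} \<and>
    (\<forall>ys\<in>E. ys \<noteq> [] \<and> distinct ys) \<and> disjoint_family_on set E \<and>
    finite E \<and> Suc (card E) = k + r \<and>
    (\<forall>ys\<in>E. \<forall>i\<in>{1..r}. \<forall>j\<in>{1..r}. i \<in> set ys \<and> j \<in> set ys \<longrightarrow> i = j)"
  (is "?L \<longleftrightarrow> ?R")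
proof -
  have "finite E" if ?L
  proof -
    have "finite (insert xs E)"
      using that by (intro finite_lah_distribution) (auto simp: r_lah_distributions_def)
    then show ?thesis by simp
  qed
  moreover have "?L \<longleftrightarrow> ?R" if "finite E"
    using that assms
    unfolding r_lah_distributions_def lah_distributions_def
    by (auto simp: disjoint_family_on_insert)
  ultimately show ?thesis by blast
qed

text \<open>The inserted element occurs nowhere else, which preserves distinctness and disjointness,
  and it exceeds \<open>r\<close>, so the separation of the elements of \<open>[r]\<close> is
  unaffected.\<close>

lemma insert_max_in_r_lah_distributions_iff:
  assumes ne: "ys @ zs \<noteq> []" and notin: "Suc (n + r) \<notin> set (ys @ zs)"
    and E: "Suc (n + r) \<notin> (\<Union>xs\<in>E. set xs)" and ysE: "ys @ zs \<notin> E"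
  shows "insert (ys @ Suc (n + r) # zs) E \<in> r_lah_distributions r (Suc n) k \<longleftrightarrow>
    insert (ys @ zs) E \<in> r_lah_distributions r n k"
proof -
  let ?m = "Suc (n + r)"
  have 1: "ys @ ?m # zs \<notin> E"
    using E by auto
  have "insert ?m A = {1..Suc n + r} \<longleftrightarrow> A = {1..n + r}" if "?m \<notin> A" for A
  proof -
    have "{1..Suc n + r} = insert ?m {1..n + r}" by auto
    then show ?thesis using that by (simp add: insert_ident)
  qed
  from this[of "set (ys @ zs) \<union> (\<Union>xs\<in>E. set xs)"] notin E
  have 2: "set (ys @ ?m # zs) \<union> (\<Union>xs\<in>E. set xs) = {1..Suc n + r} \<longleftrightarrow>
      set (ys @ zs) \<union> (\<Union>xs\<in>E. set xs) = {1..n + r}"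
    by simp
  have 3: "set (ys @ ?m # zs) \<inter> (\<Union>xs\<in>E. set xs) = {} \<longleftrightarrow> set (ys @ zs) \<inter> (\<Union>xs\<in>E. set xs) = {}"
    using E by auto
  have 4: "(\<forall>i\<in>{1..r}. \<forall>j\<in>{1..r}. i \<in> set (ys @ ?m # zs) \<and> j \<in> set (ys @ ?m # zs) \<longrightarrow> i = j) \<longleftrightarrow>
      (\<forall>i\<in>{1..r}. \<forall>j\<in>{1..r}. i \<in> set (ys @ zs) \<and> j \<in> set (ys @ zs) \<longrightarrow> i = j)"
    by (intro ball_cong refl) auto
  have 5: "distinct (ys @ ?m # zs) \<longleftrightarrow> distinct (ys @ zs)"
    using notin by auto
  show ?thesis
    unfolding insert_in_r_lah_distributions_iff[OF 1] insert_in_r_lah_distributions_iff[OF ysE]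
      2 3 4 5 using ne by simp
qed

lemma insert_singleton_max_in_r_lah_distributions_iff:
  assumes E: "Suc (n + r) \<notin> (\<Union>xs\<in>E. set xs)"
  shows "insert [Suc (n + r)] E \<in> r_lah_distributions r (Suc n) (Suc k) \<longleftrightarrow>
    E \<in> r_lah_distributions r n k"
proof -
  let ?m = "Suc (n + r)"
  have 1: "[?m] \<notin> E"
    using E by auto
  have "{1..Suc n + r} = insert ?m {1..n + r}" by auto
  then have 2: "set [?m] \<union> (\<Union>xs\<in>E. set xs) = {1..Suc n + r} \<longleftrightarrow> (\<Union>xs\<in>E. set xs) = {1..n + r}"
    using E by (simp add: insert_ident)
  \<comment> \<open>Supplies the explicit finiteness condition in the direction from right to
    left.\<close>
  have "finite E" if "E \<in> r_lah_distributions r n k"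
    using that by (intro finite_lah_distribution) (auto simp: r_lah_distributions_def)
  then show ?thesis
    unfolding insert_in_r_lah_distributions_iff[OF 1] 2
    using E by (auto simp: r_lah_distributions_def lah_distributions_def)
qed

text \<open>With only \<open>r\<close> blocks, each one must hold an element of \<open>[r]\<close>,
  which leaves no block for the largest element alone.\<close>

lemma singleton_max_notin_r_lah_distributions_0:
  assumes D: "D \<in> r_lah_distributions r (Suc n) 0"
  shows "[Suc (n + r)] \<notin> D"
proof
  let ?m = "Suc (n + r)"
  assume m: "[?m] \<in> D"
  have fin: "finite D"
    using D by (intro finite_lah_distribution) (auto simp: r_lah_distributions_def)
  have "\<exists>xs\<in>D. i \<in> set xs" if "i \<in> {1..r}" for i
  proof -
    have "i \<in> (\<Union>xs\<in>D. set xs)"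
      using D that by (auto simp: r_lah_distributions_def lah_distributions_def)
    then show ?thesis by blast
  qed
  then obtain f where f: "\<And>i. i \<in> {1..r} \<Longrightarrow> f i \<in> D \<and> i \<in> set (f i)"
    by metis
  have "inj_on f {1..r}"
  proof (rule inj_onI)
    fix i j assume ij: "i \<in> {1..r}" "j \<in> {1..r}" "f i = f j"
    then have "f i \<in> D" "i \<in> set (f i)" "j \<in> set (f i)"
      using f by metis+
    then show "i = j"
      using D ij(1,2) unfolding r_lah_distributions_def by blast
  qed
  \<comment> \<open>The block \<open>f i\<close> contains \<open>i\<close>, and \<open>i\<close> is
    at most \<open>r\<close>, hence different from \<open>?m\<close>.\<close>
  moreover have "f ` {1..r} \<subseteq> D - {[?m]}"
    using f by fastforce
  ultimately have "r \<le> card (D - {[?m]})"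
    using fin card_inj_on_le[of f "{1..r}" "D - {[?m]}"] by simp
  moreover have "card (D - {[?m]}) < card D"
    using fin m by (intro card_Diff1_less)
  ultimately show False
    using D by (simp add: r_lah_distributions_def lah_distributions_def)
qed

section \<open>Elements and lengths of the blocks\<close>

lemma r_lah_distributions_block:
  assumes D: "D \<in> r_lah_distributions r n k" and xs: "xs \<in> D"
  shows "xs \<noteq> []" "distinct xs" "i \<in> set xs \<Longrightarrow> i < Suc (n + r)"
proof -
  have "(\<Union>xs\<in>D. set xs) = {1..n + r}"
    using D by (simp add: r_lah_distributions_def lah_distributions_def)
  then have "i \<in> {1..n + r}" if "i \<in> set xs"
    using xs that by blast
  then show "i \<in> set xs \<Longrightarrow> i < Suc (n + r)"
    by auto
  show "xs \<noteq> []" "distinct xs"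
    using D xs by (auto simp: r_lah_distributions_def lah_distributions_def)
qed

lemma r_lah_distributions_disjoint:
  assumes "D \<in> r_lah_distributions r n k" "xs \<in> D" "ys \<in> D" "i \<in> set xs" "i \<in> set ys"
  shows "xs = ys"
  using assms unfolding r_lah_distributions_def lah_distributions_def disjoint_family_on_def
  by blast

lemma finite_r_lah_distribution: "D \<in> r_lah_distributions r n k \<Longrightarrow> finite D"
  by (intro finite_lah_distribution) (auto simp: r_lah_distributions_def)

text \<open>Counts the places directly behind some element, which carry the weight
  \<open>var_a\<close>.\<close>

lemma sum_length_r_lah_distribution:
  assumes D: "D \<in> r_lah_distributions r n k"
  shows "(\<Sum>xs\<in>D. length xs) = n + r"
proof -
  have "(\<Sum>xs\<in>D. length xs) = (\<Sum>xs\<in>D. card (set xs))"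
    using r_lah_distributions_block(2)[OF D] by (intro sum.cong refl) (simp add: distinct_card)
  also have "\<dots> = card (\<Union>xs\<in>D. set xs)"
    using finite_r_lah_distribution[OF D] r_lah_distributions_disjoint[OF D]
    by (intro card_UN_disjoint[symmetric]) (simp_all, blast)
  also have "\<dots> = n + r"
    using D by (simp add: r_lah_distributions_def lah_distributions_def)
  finally show ?thesis .
qed

section \<open>The largest element alone in its block\<close>

text \<open>Adding the singleton block is a bijection from the distributions with one element and
  one block fewer, and that block has weight 1.\<close>

lemma sum_weight_singleton_max:
  "(\<Sum>D | D \<in> r_lah_distributions r (Suc n) (Suc k) \<and> [Suc (n + r)] \<in> D. \<Prod>xs\<in>D. block_weight xs) =
    gen_r_lah n k r"
proof -
  let ?m = "Suc (n + r)"
  have notin: "?m \<notin> (\<Union>xs\<in>E. set xs)" if "E \<in> r_lah_distributions r n k" for E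
    using r_lah_distributions_block(3)[OF that] by blast
  have "bij_betw (insert [?m]) (r_lah_distributions r n k)
      {D \<in> r_lah_distributions r (Suc n) (Suc k). [?m] \<in> D}"
    unfolding bij_betw_def
  proof
    show "inj_on (insert [?m]) (r_lah_distributions r n k)"
    proof (rule inj_onI)
      fix D E assume *: "D \<in> r_lah_distributions r n k" "E \<in> r_lah_distributions r n k"
        "insert [?m] D = insert [?m] E"
      have "[?m] \<notin> D" "[?m] \<notin> E"
        using notin[OF *(1)] notin[OF *(2)] by auto
      with *(3) show "D = E" by (simp add: insert_ident)
    qed
    show "insert [?m] ` r_lah_distributions r n k =
        {D \<in> r_lah_distributions r (Suc n) (Suc k). [?m] \<in> D}"
    proof (intro equalityI subsetI)
      fix D assume "D \<in> insert [?m] ` r_lah_distributions r n k"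
      then show "D \<in> {D \<in> r_lah_distributions r (Suc n) (Suc k). [?m] \<in> D}"
        using insert_singleton_max_in_r_lah_distributions_iff notin by blast
    next
      fix D assume D: "D \<in> {D \<in> r_lah_distributions r (Suc n) (Suc k). [?m] \<in> D}"
      \<comment> \<open>By disjointness the singleton is the only block containing
        \<open>?m\<close>, so removing it removes \<open>?m\<close> altogether.\<close>
      have "xs = [?m]" if "xs \<in> D" "?m \<in> set xs" for xs
        using r_lah_distributions_disjoint[of D r "Suc n" "Suc k" xs "[?m]" ?m] D that by simp
      then have "?m \<notin> (\<Union>xs\<in>D - {[?m]}. set xs)"
        by blast
      then have "D - {[?m]} \<in> r_lah_distributions r n k"
        using insert_singleton_max_in_r_lah_distributions_iff[of n r "D - {[?m]}" k] D
        by (simp add: insert_absorb)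
      then show "D \<in> insert [?m] ` r_lah_distributions r n k"
        using D by (intro image_eqI[of _ _ "D - {[?m]}"]) auto
    qed
  qed
  then have "(\<Sum>D | D \<in> r_lah_distributions r (Suc n) (Suc k) \<and> [?m] \<in> D. \<Prod>xs\<in>D. block_weight xs) =
      (\<Sum>D\<in>r_lah_distributions r n k. \<Prod>xs\<in>insert [?m] D. block_weight xs)"
    by (simp add: sum.reindex_bij_betw[symmetric])
  also have "\<dots> = (\<Sum>D\<in>r_lah_distributions r n k. \<Prod>xs\<in>D. block_weight xs)"
  proof (rule sum.cong[OF refl])
    fix D assume D: "D \<in> r_lah_distributions r n k"
    have "[?m] \<notin> D"
      using notin[OF D] by auto
    then show "(\<Prod>xs\<in>insert [?m] D. block_weight xs) = (\<Prod>xs\<in>D. block_weight xs)"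
      using finite_r_lah_distribution[OF D] by (simp add: block_weight_singleton)
  qed
  finally show ?thesis
    by (simp add: gen_r_lah_eq_sum)
qed

section \<open>The largest element inserted into an existing block\<close>

text \<open>Position 0 is the front of the block; a position \<open>p > 0\<close> is directly behind
  the \<open>p\<close>-th element. Distinct positions are meant to range over
  \<open>{..length xs}\<close>, since \<open>take\<close> and \<open>drop\<close> do not distinguish
  larger values.\<close>

definition insert_at :: "nat \<Rightarrow> nat list set \<times> nat list \<times> nat \<Rightarrow> nat list set" where
  "insert_at m = (\<lambda>(D, xs, p). insert (take p xs @ m # drop p xs) (D - {xs}))"

text \<open>The inverse deletes the largest element from its block and records the block and the
  position. The block stays non-empty because the singleton is excluded.\<close>

lemma bij_betw_insert_at:
  "bij_betw (insert_at (Suc (n + r)))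
    (SIGMA D:r_lah_distributions r n k. SIGMA xs:D. {..length xs})
    {D \<in> r_lah_distributions r (Suc n) k. [Suc (n + r)] \<notin> D}"
    (is "bij_betw ?f ?S ?B")
proof -
  let ?m = "Suc (n + r)"
  have notin: "?m \<notin> set xs" if "E \<in> r_lah_distributions r n k" "xs \<in> E" for E xs
    using r_lah_distributions_block(3)[OF that] by blast
  show ?thesis
    unfolding bij_betw_def
  proof
    show "inj_on ?f ?S"
    proof (rule inj_onI)
      fix s t assume s: "s \<in> ?S" and t: "t \<in> ?S" and eq: "?f s = ?f t"
      obtain D xs p where s_eq: "s = (D, xs, p)" by (cases s)
      obtain E ys q where t_eq: "t = (E, ys, q)" by (cases t)
      have D: "D \<in> r_lah_distributions r n k" "xs \<in> D" "p \<le> length xs"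
        using s s_eq by auto
      have E: "E \<in> r_lah_distributions r n k" "ys \<in> E" "q \<le> length ys"
        using t t_eq by auto
      let ?x = "take p xs @ ?m # drop p xs" and ?y = "take q ys @ ?m # drop q ys"
      have eq': "insert ?x (D - {xs}) = insert ?y (E - {ys})"
        using eq by (simp add: s_eq t_eq insert_at_def)
      have mem: "?m \<in> set ?x" "?m \<in> set ?y"
        by auto
      \<comment> \<open>The modified blocks are the only ones containing \<open>?m\<close>, so
        \<open>eq'\<close> must match them with each other.\<close>
      have "?x \<notin> E" "?x \<notin> D" "?y \<notin> E"
        using notin[OF E(1)] notin[OF D(1)] mem by blast+
      with eq' have xy: "?x = ?y"
        by blast
      with eq' \<open>?x \<notin> D\<close> \<open>?y \<notin> E\<close> have DE: "D - {xs} = E - {ys}"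
        by (metis Diff_iff insert_ident)
      \<comment> \<open>As \<open>?m\<close> occurs once in \<open>?x\<close>, the parts before and
        after it are determined.\<close>
      have "?m \<notin> set (take p xs)" "?m \<notin> set (drop p xs)"
        using notin[OF D(1,2)] by (meson in_set_takeD in_set_dropD)+
      then have td: "take p xs = take q ys" "drop p xs = drop q ys"
        using xy by (auto simp: append_Cons_eq_iff)
      have "xs = ys"
        using td by (metis append_take_drop_id)
      moreover have "p = q"
        \<comment> \<open>The bounds on \<open>p\<close> and \<open>q\<close> make them the lengths
          of the prefixes.\<close>
        using arg_cong[OF td(1), of length] D(3) E(3) by simp
      moreover have "D = E"
        using DE D(2) E(2) \<open>xs = ys\<close> by blast
      ultimately show "s = t"
        using s_eq t_eq by simp
    qed
    show "?f ` ?S = ?B"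
    proof (intro equalityI subsetI)
      fix D' assume "D' \<in> ?f ` ?S"
      then obtain D xs p where D: "D \<in> r_lah_distributions r n k" "xs \<in> D" "p \<le> length xs"
        and D': "D' = insert (take p xs @ ?m # drop p xs) (D - {xs})"
        by (auto simp: insert_at_def)
      have ne: "xs \<noteq> []"
        using r_lah_distributions_block(1) D(1,2) .
      have E: "?m \<notin> (\<Union>ys\<in>D - {xs}. set ys)"
        using notin[OF D(1)] by blast
      have "insert xs (D - {xs}) \<in> r_lah_distributions r n k"
        using D by (simp add: insert_absorb)
      then have "D' \<in> r_lah_distributions r (Suc n) k"
        using insert_max_in_r_lah_distributions_iff[of "take p xs" "drop p xs" n r "D - {xs}" k]
          ne notin[OF D(1,2)] E D' by simp
      moreover have "take p xs @ ?m # drop p xs \<noteq> [?m]"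
        using ne by (cases p; cases xs) auto
      then have "[?m] \<notin> D'"
        using D' notin[OF D(1), of "[?m]"] by auto
      ultimately show "D' \<in> ?B"
        by simp
    next
      fix D' assume "D' \<in> ?B"
      then have D': "D' \<in> r_lah_distributions r (Suc n) k" and m: "[?m] \<notin> D'"
        by auto
      have "?m \<in> (\<Union>xs\<in>D'. set xs)"
        using D' by (simp add: r_lah_distributions_def lah_distributions_def)
      then obtain b where b: "b \<in> D'" "?m \<in> set b"
        by blast
      then obtain ys zs where b_eq: "b = ys @ ?m # zs"
        by (meson split_list)
      let ?E = "D' - {b}"
      have E: "?m \<notin> (\<Union>xs\<in>?E. set xs)"
        using r_lah_distributions_disjoint[OF D'] b by blast
      have ne: "ys @ zs \<noteq> []"
        using b(1) m b_eq by auto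
      \<comment> \<open>Otherwise another block would share an element with \<open>b\<close>. Thus
        adding the shortened block to \<open>?E\<close> and taking it out again gives back
        \<open>?E\<close>.\<close>
      have "ys @ zs \<notin> ?E"
      proof
        assume c: "ys @ zs \<in> ?E"
        obtain i where i: "i \<in> set (ys @ zs)"
          using ne by (meson list.set_sel(1))
        then have "i \<in> set b"
          using b_eq by auto
        then show False
          using r_lah_distributions_disjoint[OF D' _ b(1) i] c by blast
      qed
      moreover have "?m \<notin> set (ys @ zs)"
        using r_lah_distributions_block(2)[OF D' b(1)] b_eq by auto
      ultimately have D: "insert (ys @ zs) ?E \<in> r_lah_distributions r n k"
        using insert_max_in_r_lah_distributions_iff[of ys zs n r ?E k] ne E D' b(1) b_eq
        by (simp add: insert_absorb)
      have "D' = ?f (insert (ys @ zs) ?E, ys @ zs, length ys)"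
        using \<open>ys @ zs \<notin> ?E\<close> b b_eq by (auto simp: insert_at_def)
      moreover have "(insert (ys @ zs) ?E, ys @ zs, length ys) \<in> ?S"
        using D by simp
      ultimately show "D' \<in> ?f ` ?S"
        by (rule image_eqI)
    qed
  qed
qed

text \<open>Only the factor of the block \<open>xs\<close> changes; since \<open>xs\<close> is
  non-empty, the prefix \<open>take p xs\<close> is empty exactly for \<open>p = 0\<close>.\<close>

lemma prod_block_weight_insert_at:
  assumes D: "D \<in> r_lah_distributions r n k" "xs \<in> D"
  shows "(\<Prod>ys\<in>insert_at (Suc (n + r)) (D, xs, p). block_weight ys) =
    (if p = 0 then var_b else var_a) * (\<Prod>ys\<in>D. block_weight ys)"
proof -
  let ?m = "Suc (n + r)"
  have fin: "finite D"
    using finite_r_lah_distribution D(1) .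
  have ne: "xs \<noteq> []"
    using r_lah_distributions_block(1) D .
  have "take p xs @ ?m # drop p xs \<notin> D"
    using r_lah_distributions_block(3)[OF D(1), of "take p xs @ ?m # drop p xs" ?m] by auto
  then have "(\<Prod>ys\<in>insert_at ?m (D, xs, p). block_weight ys) =
      block_weight (take p xs @ ?m # drop p xs) * (\<Prod>ys\<in>D - {xs}. block_weight ys)"
    using fin by (simp add: insert_at_def)
  also have "block_weight (take p xs @ ?m # drop p xs) =
      (if p = 0 then var_b else var_a) * block_weight xs"
    using block_weight_insert_max[of "take p xs" "drop p xs" ?m] r_lah_distributions_block(3)[OF D] ne
    by simp
  finally show ?thesis
    using prod.remove[OF fin D(2), of block_weight] by (simp add: mult.assoc)
qed

text \<open>The factors \<open>?c p\<close>, summed over all places of \<open>D\<close>, give the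
  same value for every \<open>D\<close>: there are \<open>k + r\<close> fronts and
  \<open>n + r\<close> places behind an element.\<close>

lemma sum_weight_not_singleton_max:
  "(\<Sum>D | D \<in> r_lah_distributions r (Suc n) k \<and> [Suc (n + r)] \<notin> D. \<Prod>xs\<in>D. block_weight xs) =
    (var_a * of_nat (n + r) + var_b * of_nat (k + r)) * gen_r_lah n k r"
proof -
  let ?R = "r_lah_distributions r n k"
  let ?w = "\<lambda>D. \<Prod>xs\<in>D. block_weight xs"
  let ?c = "\<lambda>p :: nat. if p = 0 then var_b else var_a"
  \<comment> \<open>A block of length \<open>l\<close> offers \<open>l + 1\<close> places, one of
    them at the front.\<close>
  have c: "(\<Sum>p\<le>l. ?c p) = var_b + of_nat l * var_a" for l
    by (induction l) (simp_all add: algebra_simps)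
  have "(\<Sum>D | D \<in> r_lah_distributions r (Suc n) k \<and> [Suc (n + r)] \<notin> D. ?w D) =
      (\<Sum>s\<in>(SIGMA D:?R. SIGMA xs:D. {..length xs}). ?w (insert_at (Suc (n + r)) s))"
    using bij_betw_insert_at by (rule sum.reindex_bij_betw[symmetric])
  also have "\<dots> = (\<Sum>s\<in>(SIGMA D:?R. SIGMA xs:D. {..length xs}). ?c (snd (snd s)) * ?w (fst s))"
    by (intro sum.cong refl) (clarsimp simp: prod_block_weight_insert_at)
  also have "\<dots> = (\<Sum>D\<in>?R. \<Sum>t\<in>(SIGMA xs:D. {..length xs}). ?c (snd t) * ?w D)"
    using finite_r_lah_distributions finite_r_lah_distribution
    by (subst sum.Sigma) (auto simp: case_prod_unfold)
  also have "\<dots> = (\<Sum>D\<in>?R. (var_a * of_nat (n + r) + var_b * of_nat (k + r)) * ?w D)"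
  proof (rule sum.cong[OF refl])
    fix D assume D: "D \<in> ?R"
    have "(\<Sum>t\<in>(SIGMA xs:D. {..length xs}). ?c (snd t)) = (\<Sum>xs\<in>D. \<Sum>p\<le>length xs. ?c p)"
      using finite_r_lah_distribution[OF D] by (subst sum.Sigma) (auto simp: case_prod_unfold)
    also have "\<dots> = of_nat (card D) * var_b + of_nat (\<Sum>xs\<in>D. length xs) * var_a"
      unfolding c by (simp add: sum.distrib sum_distrib_right)
    also have "\<dots> = var_a * of_nat (n + r) + var_b * of_nat (k + r)"
      using D unfolding sum_length_r_lah_distribution[OF D]
      by (simp add: r_lah_distributions_def lah_distributions_def algebra_simps)
    finally show "(\<Sum>t\<in>(SIGMA xs:D. {..length xs}). ?c (snd t) * ?w D) =
        (var_a * of_nat (n + r) + var_b * of_nat (k + r)) * ?w D"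
      by (simp only: sum_distrib_right[symmetric])
  qed
  finally show ?thesis
    by (simp add: gen_r_lah_eq_sum sum_distrib_left)
qed

section \<open>The recurrence\<close>

text \<open>The first sum is left unevaluated because its value depends on whether \<open>k\<close>
  is positive or 0.\<close>

lemma gen_r_lah_Suc_split:
  "gen_r_lah (Suc n) k r =
    (\<Sum>D | D \<in> r_lah_distributions r (Suc n) k \<and> [Suc (n + r)] \<in> D. \<Prod>xs\<in>D. block_weight xs) +
    (var_a * of_nat (n + r) + var_b * of_nat (k + r)) * gen_r_lah n k r"
proof -
  let ?R = "r_lah_distributions r (Suc n) k"
  have "?R = {D \<in> ?R. [Suc (n + r)] \<in> D} \<union> {D \<in> ?R. [Suc (n + r)] \<notin> D}"
    by blast
  then have "gen_r_lah (Suc n) k r =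
      (\<Sum>D\<in>{D \<in> ?R. [Suc (n + r)] \<in> D} \<union> {D \<in> ?R. [Suc (n + r)] \<notin> D}. \<Prod>xs\<in>D. block_weight xs)"
    by (simp add: gen_r_lah_eq_sum)
  also have "\<dots> = (\<Sum>D | D \<in> ?R \<and> [Suc (n + r)] \<in> D. \<Prod>xs\<in>D. block_weight xs) +
      (\<Sum>D | D \<in> ?R \<and> [Suc (n + r)] \<notin> D. \<Prod>xs\<in>D. block_weight xs)"
    using finite_r_lah_distributions by (intro sum.union_disjoint) auto
  finally show ?thesis
    by (simp only: sum_weight_not_singleton_max)
qed

lemma gen_r_lah_Suc_Suc:
  "gen_r_lah (Suc n) (Suc k) r = gen_r_lah n k r +
    (var_a * of_nat (n + r) + var_b * of_nat (Suc k + r)) * gen_r_lah n (Suc k) r"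
  by (simp only: gen_r_lah_Suc_split sum_weight_singleton_max)

lemma gen_r_lah_Suc_0:
  "gen_r_lah (Suc n) 0 r = (var_a * of_nat (n + r) + var_b * of_nat r) * gen_r_lah n 0 r"
proof -
  have "{D \<in> r_lah_distributions r (Suc n) 0. [Suc (n + r)] \<in> D} = {}"
    using singleton_max_notin_r_lah_distributions_0 by blast
  then show ?thesis
    by (simp only: gen_r_lah_Suc_split sum.empty add_0)
qed

section \<open>Iteration of the recurrence\<close>

text \<open>Induction on \<open>n\<close> with the number of blocks fixed: each step extends all
  earlier products by the factor for \<open>j = n\<close> and contributes one new term.\<close>

lemma gen_r_lah_vertical:
  assumes "Suc k \<le> n"
  shows "gen_r_lah n (Suc k) r = (\<Sum>i=Suc k..n. gen_r_lah (i - 1) k r *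
    (\<Prod>j=i..<n. var_a * of_nat j + var_b * of_nat (Suc k) + (var_a + var_b) * of_nat r))"
  using assms
proof (induction n rule: dec_induct)
  case base
  \<comment> \<open>Removes the second summand of the recurrence; what remains is the term
    \<open>i = Suc k\<close> with an empty product.\<close>
  have "gen_r_lah k (Suc k) r = 0"
    by (simp add: gen_r_lah_def)
  then show ?case
    by (simp add: gen_r_lah_Suc_Suc)
next
  case (step n)
  let ?c = "\<lambda>j. var_a * of_nat j + var_b * of_nat (Suc k) + (var_a + var_b) * of_nat r"
  have "gen_r_lah (Suc n) (Suc k) r = gen_r_lah n k r + gen_r_lah n (Suc k) r * ?c n"
    unfolding gen_r_lah_Suc_Suc by (simp add: algebra_simps)
  also have "gen_r_lah n (Suc k) r * ?c n =
      (\<Sum>i=Suc k..n. gen_r_lah (i - 1) k r * (\<Prod>j=i..<Suc n. ?c j))"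
    unfolding step.IH sum_distrib_right
    by (intro sum.cong refl) (simp add: prod.atLeastLessThan_Suc mult.assoc del: of_nat_Suc)
  \<comment> \<open>The summand \<open>gen_r_lah n k r\<close> is the new term
    \<open>i = Suc n\<close>, whose product is empty.\<close>
  finally show ?case
    using step.hyps by (simp add: add.commute del: of_nat_Suc)
qed

text \<open>Here the first summand of the recurrence is expanded, so \<open>n\<close> and
  \<open>k\<close> decrease together until \<open>k = 0\<close>, where there is no first summand. As
  \<open>i \<le> k < n\<close>, all subtractions are exact.\<close>

lemma gen_r_lah_diagonal:
  assumes "k < n"
  shows "gen_r_lah n k r =
    (\<Sum>i=0..k. (var_a * of_nat (n + r - i - 1) + var_b * of_nat (k + r - i)) *
      gen_r_lah (n - i - 1) (k - i) r)"
  using assms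
proof (induction k arbitrary: n)
  case 0
  then show ?case
    by (cases n) (simp_all add: gen_r_lah_Suc_0)
next
  case (Suc k)
  then obtain l where n: "n = Suc l" and "k < l"
    by (cases n) auto
  from Suc.IH[OF \<open>k < l\<close>] show ?case
    \<comment> \<open>The term \<open>i = 0\<close> is the second summand of the recurrence; the
      other terms, shifted by one, are the induction hypothesis for \<open>l\<close> and
      \<open>k\<close>.\<close>
    unfolding n gen_r_lah_Suc_Suc sum.atLeast0_atMost_Suc_shift
    by (simp del: of_nat_Suc of_nat_add)
qed

theorem theorem2p3:
  fixes r :: nat
  shows "(\<forall>n k :: nat. 1 \<le> k \<and> k \<le> n \<longrightarrow>
            gen_r_lah n k r =
              (\<Sum>i=k..n. gen_r_lah (i - 1) (k - 1) r *
                 (\<Prod>j=i..<n. var_a * of_nat j + var_b * of_nat k + (var_a + var_b) * of_nat r)))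
       \<and> (\<forall>n k :: nat. k < n \<longrightarrow>
            gen_r_lah n k r =
              (\<Sum>i=0..k. (var_a * of_nat (n + r - i - 1) + var_b * of_nat (k + r - i)) *
                 gen_r_lah (n - i - 1) (k - i) r))"
proof (intro conjI allI impI)
  fix n k :: nat
  assume "1 \<le> k \<and> k \<le> n"
  then obtain l where "k = Suc l" "Suc l \<le> n"
    by (cases k) auto
  then show "gen_r_lah n k r = (\<Sum>i=k..n. gen_r_lah (i - 1) (k - 1) r *
      (\<Prod>j=i..<n. var_a * of_nat j + var_b * of_nat k + (var_a + var_b) * of_nat r))"
    using gen_r_lah_vertical[of l n r] by simp
next
  fix n k :: nat
  assume "k < n"
  then show "gen_r_lah n k r =
      (\<Sum>i=0..k. (var_a * of_nat (n + r - i - 1) + var_b * of_nat (k + r - i)) *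
        gen_r_lah (n - i - 1) (k - i) r)"
    by (rule gen_r_lah_diagonal)
qed

end
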